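(* Let $N\ge 0$ be an even integer. Then the $(N+1)\times(N+1)$ symmetric Pascal matrix $T_N$ has a unique eigenvector $\vec v=(v_k)_{k=0}^N$ with eigenvalue $\lambda=1$ normalized by $v_N=1$, and it is given by the generating function formula $$\sum_{k=0}^N v_k z^{N-k} = {}_2F_1\!\left(-\tfrac N2,\tfrac N2+1;-N;z\right)\cdot {}_2F_1\!\left(-\tfrac N2,\tfrac N2+1;-N;\tfrac{z}{z-1}\right)(1-z)^{N/2}.$$
   Context: The symmetric Pascal matrix $T_N$ is the $(N+1)\times(N+1)$ matrix with entries $(T_N)_{j,k}=\binom{j+k}{j}$ for $0\le j,k\le N$. For $N$ even, ${}_2F_1(-N/2,N/2+1;-N;x)$ denotes the terminating hypergeometric polynomial $\sum_{k=0}^{N/2}\frac{(-N/2)_k(N/2+1)_k}{(-N)_k\,k!}x^k$, where $(q)_k=q(q+1)\cdots(q+k-1)$ is the rising Pochhammer symbol with $(q)_0=1$. The right-hand side of the formula is a polynomial in $z$. *)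

theory Defs
  imports Complex_Main "Jordan_Normal_Form.Char_Poly"
begin

definition sym_pascal_mat :: "nat \<Rightarrow> complex mat" where
  "sym_pascal_mat N = mat (N + 1) (N + 1) (\<lambda>(j, k). of_nat ((j + k) choose j))"

(* The terminating polynomial 2F1(-N/2, N/2 + 1; -N; x) for even N. Here k <= N/2 <= N, so
   the Pochhammer symbol in the denominator does not vanish. *)
definition hyp_poly :: "nat \<Rightarrow> complex \<Rightarrow> complex" where
  "hyp_poly N x =
     (\<Sum>k = 0..N div 2.
        (pochhammer (- (of_nat N / 2)) k * pochhammer (of_nat N / 2 + 1) k) /
        (pochhammer (- of_nat N) k * fact k) * x ^ k)"

end

theory Submission
  imports Defs "HOL-Computational_Algebra.Formal_Power_Series"
begin

text \<open>
  Write $N = 2n$, $T$ for the Pascal matrix, and call $v$ fixed if $Tv = v$. The fixed vector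
  is found as the kernel of a tridiagonal matrix that commutes with $T$, and its uniqueness
  comes from a positivity argument.

  Uniqueness. A fixed vector $u$ with $u_0 = 0$ is zero: the partial sums of $u$ form an
  eigenvector with eigenvalue $-1$ of the shifted matrix with entries $\binom{j+k+3}{j}$, and
  such an eigenvalue is impossible because this matrix becomes positive semidefinite when its
  rows are multiplied by suitable positive numbers (\<open>pascal_fixed_vector_eq_0\<close>,
  \<open>shifted_pascal_no_eigenvalue_minus_one\<close>). Hence the fixed vectors form a space
  of dimension at most one, and the normalization $v_N = 1$ leaves at most one of them.

  Existence and formula. $T$ commutes with a symmetric tridiagonal matrix $J$ whose entries
  are cubic polynomials in the index (\<open>jac_pascal_commute\<close>). A vector of the
  kernel of $J$ is determined by its first entry, so if $Je = 0$ and the entries of $e$ add up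
  to $e_0$, which is row $0$ of the equation $Te = e$, then the whole equation holds
  (\<open>jac_kernel_pascal_fixed\<close>). It remains to see that the reversed coefficients
  of the right-hand side have these two properties. Pfaff's transformation rewrites the second
  factor together with the power of $1 - z$ as $q(z) = {}_2F_1(-n, -3n-1; -2n; z)$, so the
  right-hand side is the product $pq$ of two polynomials with $p(z) = {}_2F_1(-n, n+1; -2n;
  z)$. Both hypergeometric equations have the same exponent differences $2n+1$ at $0$, $1$ and
  $\infty$, and so $q = (1-z)^{2n+1} y$ with $y$ a solution of the equation of $p$. Therefore
  $pq$ satisfies a differential equation of order three, a twisted symmetric square, and its
  coefficient form is the three-term recurrence $Je = 0$ (\<open>hyp2F1_product_ode\<close>,
  \<open>ode_recurrence\<close>). The condition on the sum says that the value of $pq$ at $1$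
  is its coefficient of $z^{2n}$, which follows from the Chu--Vandermonde identity
  (\<open>hyp2F1_product_at_1\<close>).
\<close>

section \<open>Fixed vectors of the Pascal matrix are determined by their first entry\<close>

definition pascal_op :: "nat \<Rightarrow> (nat \<Rightarrow> complex) \<Rightarrow> nat \<Rightarrow> complex" where
  "pascal_op N v j = (\<Sum>k\<le>N. of_nat ((j + k) choose j) * v k)"

text \<open>The weights $i!/(i+r)!$ turn the shifted lower Pascal factor into the unshifted one; this is
  what makes the shifted Pascal matrix symmetrizable.\<close>
lemma fact_ratio_choose:
  "(fact j / fact (j + r)) * of_nat ((j + r) choose (i + r))
   = (fact i / fact (i + r)) * (of_nat (j choose i) :: 'a::field_char_0)"
proof (cases "i \<le> j")
  case True
  have "of_nat ((j + r) choose (i + r)) = (fact (j + r) / (fact (i + r) * fact (j - i)) :: 'a)"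
    using True by (simp add: binomial_fact)
  moreover have "of_nat (j choose i) = (fact j / (fact i * fact (j - i)) :: 'a)"
    using True by (simp add: binomial_fact)
  ultimately show ?thesis by simp
qed (simp add: binomial_eq_0)

text \<open>Vandermonde's convolution, read as a factorization of the shifted Pascal matrix into a lower
  and an upper unitriangular factor.\<close>
lemma shifted_pascal_LU:
  assumes "j < n"
  shows "(j + k + r) choose j = (\<Sum>i<n. ((j + r) choose (i + r)) * (k choose i))"
proof -
  have "(j + k + r) choose j = (\<Sum>i\<le>j. (k choose i) * ((j + r) choose (j - i)))"
    using vandermonde[of k "j + r" j] by (simp add: algebra_simps)
  also have "\<dots> = (\<Sum>i\<le>j. ((j + r) choose (i + r)) * (k choose i))"
  proof (rule sum.cong)
    fix i assume "i \<in> {..j}"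
    then show "(k choose i) * ((j + r) choose (j - i)) = ((j + r) choose (i + r)) * (k choose i)"
      using binomial_symmetric[of "j - i" "j + r"] by (simp add: algebra_simps)
  qed simp
  also have "\<dots> = (\<Sum>i<n. ((j + r) choose (i + r)) * (k choose i))"
    using assms by (intro sum.mono_neutral_left) (auto simp: binomial_eq_0)
  finally show ?thesis .
qed

text \<open>After multiplication of row $j$ by $g_j = j!/(j+r)!$, the triangular factorization of the
  shifted Pascal matrix becomes $L\, \mathrm{diag}(g)\, L^T$ with $L$ the Pascal triangle, so
  the weighted matrix is positive semidefinite. For an eigenvector $w$ with eigenvalue $-1$
  the quadratic form equals $-\sum_j g_j |w_j|^2$, which forces $w = 0$.\<close>
lemma shifted_pascal_no_eigenvalue_minus_one:
  fixes w :: "nat \<Rightarrow> complex"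
  assumes eig: "\<And>j. j < n \<Longrightarrow> (\<Sum>k<n. of_nat ((j + k + r) choose j) * w k) = - w j"
    and "j < n"
  shows "w j = 0"
proof -
  define g :: "nat \<Rightarrow> real" where "g i = fact i / fact (i + r)" for i
  define y where "y i = (\<Sum>k<n. of_nat (k choose i) * w k)" for i
  have cnj_mult_self: "cnj x * x = (of_real (cmod x))\<^sup>2" for x
    by (metis complex_norm_square mult.commute of_real_power)
  have gpos: "g i > 0" for i by (simp add: g_def)
  have g_choose: "of_real (g j) * of_nat ((j + r) choose (i + r))
      = of_real (g i) * (of_nat (j choose i) :: complex)" for i j
    using fact_ratio_choose[of j r i, where 'a=complex] by (simp add: g_def)
  have "- (\<Sum>j<n. of_real (g j) * (cnj (w j) * w j))
      = (\<Sum>j<n. cnj (w j) * of_real (g j) * (\<Sum>k<n. of_nat ((j + k + r) choose j) * w k))"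
    unfolding sum_negf[symmetric] by (intro sum.cong refl) (simp add: eig)
  also have "\<dots> = (\<Sum>j<n. cnj (w j) * of_real (g j) *
      (\<Sum>k<n. (\<Sum>i<n. of_nat ((j + r) choose (i + r)) * of_nat (k choose i)) * w k))"
    by (simp add: shifted_pascal_LU)
  also have "\<dots> = (\<Sum>j<n. cnj (w j) * of_real (g j) * (\<Sum>i<n. of_nat ((j + r) choose (i + r)) * y i))"
    unfolding y_def sum_distrib_right sum_distrib_left
    by (subst (2) sum.swap) (simp add: mult.assoc)
  also have "\<dots> = (\<Sum>j<n. \<Sum>i<n. cnj (w j) * (of_real (g j) * of_nat ((j + r) choose (i + r))) * y i)"
    by (simp add: sum_distrib_left mult.assoc)
  also have "\<dots> = (\<Sum>i<n. \<Sum>j<n. of_real (g i) * (cnj (w j) * of_nat (j choose i) * y i))"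
    unfolding g_choose by (subst sum.swap) (simp add: mult_ac)
  also have "\<dots> = (\<Sum>i<n. of_real (g i) * (cnj (y i) * y i))"
    by (simp add: y_def sum_distrib_left sum_distrib_right mult_ac)
  finally have "of_real (- (\<Sum>j<n. g j * (cmod (w j))\<^sup>2)) = (of_real (\<Sum>i<n. g i * (cmod (y i))\<^sup>2) :: complex)"
    by (simp add: cnj_mult_self)
  then have "- (\<Sum>j<n. g j * (cmod (w j))\<^sup>2) = (\<Sum>i<n. g i * (cmod (y i))\<^sup>2)"
    using of_real_eq_iff by blast
  moreover have "(\<Sum>i<n. g i * (cmod (y i))\<^sup>2) \<ge> 0"
    using gpos by (intro sum_nonneg mult_nonneg_nonneg) (auto simp: less_imp_le)
  moreover have nn: "g j * (cmod (w j))\<^sup>2 \<ge> 0" for j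
    using gpos[of j] by simp
  ultimately have "(\<Sum>j<n. g j * (cmod (w j))\<^sup>2) = 0"
    using sum_nonneg[of "{..<n}" "\<lambda>j. g j * (cmod (w j))\<^sup>2"] by simp
  then have "g j * (cmod (w j))\<^sup>2 = 0"
    using nn \<open>j < n\<close> by (subst (asm) sum_nonneg_eq_0_iff) auto
  then show ?thesis using gpos[of j] by simp
qed

lemma sum_by_parts:
  fixes c u :: "nat \<Rightarrow> 'a::comm_ring_1"
  shows "(\<Sum>k\<le>m. c k * u k)
    = c (Suc m) * sum u {..m} - (\<Sum>k\<le>m. (c (Suc k) - c k) * sum u {..k})"
  by (induction m) (simp_all add: algebra_simps)

text \<open>Let $s_k = u_0 + \dots + u_k$. Row $0$ of
  $Tu = u$ says $s_N = u_0 = 0$, so that summation by parts has no boundary term, and Pascal's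
  rule turns row $i+1$ into a formula for $u_{i+1}$ in terms of the $s_k$. Adding these rows
  up shows that $(s_1, \dots, s_N)$ is an eigenvector of the Pascal matrix shifted by $3$ with
  eigenvalue $-1$, hence zero. In terms of the polynomial $\sum_k u_k z^k$, which vanishes at
  $0$ and $1$, the sequence $s$ collects the coefficients after division by $1 - z$.\<close>
lemma pascal_fixed_vector_eq_0:
  assumes fixed: "\<And>j. j \<le> N \<Longrightarrow> pascal_op N u j = u j"
    and u0: "u 0 = 0" and "k \<le> N"
  shows "u k = 0"
proof -
  define s where "s k = sum u {..k}" for k
  have s0: "s 0 = 0" by (simp add: s_def u0)
  have sN: "s N = 0"
    using fixed[of 0] u0 by (simp add: pascal_op_def s_def)
  have u_Suc: "u (Suc i) = - (\<Sum>k\<le>N. of_nat ((k + 1 + i) choose i) * s k)" if "i < N" for i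
  proof -
    have "u (Suc i) = (\<Sum>k\<le>N. of_nat ((Suc i + k) choose (Suc i)) * u k)"
      using fixed[of "Suc i"] that by (simp add: pascal_op_def)
    also have "\<dots> = - (\<Sum>k\<le>N. (of_nat ((Suc i + Suc k) choose (Suc i)) - of_nat ((Suc i + k) choose (Suc i))) * s k)"
      by (subst sum_by_parts) (simp add: s_def[symmetric] sN)
    also have "\<dots> = - (\<Sum>k\<le>N. of_nat ((k + 1 + i) choose i) * s k)"
      by (simp add: add_ac)
    finally show ?thesis .
  qed
  \<comment> \<open>Adding the rows up to $j$ raises the shift from 1 to 2; dropping $s_0 = 0$ raises it to 3.\<close>
  have "s (Suc j) = 0" if "j < N" for j
    using _ that
  proof (rule shifted_pascal_no_eigenvalue_minus_one[where r = 3])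
    fix j assume j: "j < N"
    have "s (Suc j) = (\<Sum>i\<le>j. u (Suc i))"
      unfolding s_def by (subst sum.atMost_Suc_shift) (simp add: u0)
    also have "\<dots> = (\<Sum>i\<le>j. - (\<Sum>k\<le>N. of_nat ((k + 1 + i) choose i) * s k))"
      using j by (intro sum.cong) (auto simp: u_Suc)
    also have "\<dots> = - (\<Sum>k\<le>N. of_nat (\<Sum>i\<le>j. (k + 1 + i) choose i) * s k)"
      by (simp add: sum_negf sum_distrib_right) (rule sum.swap)
    also have "\<dots> = - (\<Sum>k\<le>N. of_nat ((j + k + 2) choose j) * s k)"
      by (subst sum_choose_lower) (simp add: add_ac)
    also have "\<dots> = - (\<Sum>k<N. of_nat ((j + k + 3) choose j) * s (Suc k))"
      by (subst sum.atMost_shift) (simp add: s0 numeral_eq_Suc)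
    finally show "(\<Sum>k<N. of_nat ((j + k + 3) choose j) * s (Suc k)) = - s (Suc j)"
      by simp
  qed
  then have s_zero: "s k = 0" if "k \<le> N" for k
    using that s0 by (cases k) auto
  show ?thesis
  proof (cases k)
    case (Suc i)
    then have "u k = s k - s i" by (simp add: s_def)
    then show ?thesis using Suc s_zero \<open>k \<le> N\<close> by simp
  qed (simp add: u0)
qed

text \<open>Two fixed vectors $u$ and $v$ are proportional because $v_0 u - u_0 v$ is fixed with first
  entry zero.\<close>
lemma pascal_fixed_unique:
  assumes u: "\<And>j. j \<le> N \<Longrightarrow> pascal_op N u j = u j" and v: "\<And>j. j \<le> N \<Longrightarrow> pascal_op N v j = v j"
    and "u N = 1" "v N = 1" "k \<le> N"
  shows "u k = v k"
proof -
  have proportional: "v 0 * u i = u 0 * v i" if "i \<le> N" for i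
  proof -
    have "pascal_op N (\<lambda>i. v 0 * u i - u 0 * v i) j = v 0 * pascal_op N u j - u 0 * pascal_op N v j" for j
      by (simp add: pascal_op_def sum_distrib_left sum_subtractf algebra_simps)
    then show ?thesis
      using pascal_fixed_vector_eq_0[of N "\<lambda>i. v 0 * u i - u 0 * v i" i] u v that by simp
  qed
  from proportional[of N] have "u 0 = v 0" using assms(3,4) by simp
  moreover have "v 0 \<noteq> 0"
    using pascal_fixed_vector_eq_0[of N v N] v \<open>v N = 1\<close> by auto
  ultimately show ?thesis using proportional[OF \<open>k \<le> N\<close>] by simp
qed

section \<open>A commuting tridiagonal matrix\<close>

text \<open>A real symmetric tridiagonal matrix $J$ that commutes with the Pascal matrix. Row $k$ has
  the off-diagonal entries $b_k$ (left) and $b_{k+1}$ (right), where $b_l = l(l^2 - (N+1)^2)$;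
  the zeros of $b$ at $0$ and $N+1$ are what cuts the three-term operator off to the index
  range $0, \dots, N$.\<close>
definition jac_off :: "nat \<Rightarrow> nat \<Rightarrow> complex" where
  "jac_off N l = of_nat l * ((of_nat l)\<^sup>2 - (of_nat N + 1)\<^sup>2)"

definition jac_diag :: "nat \<Rightarrow> nat \<Rightarrow> complex" where
  "jac_diag N l = - (2 * of_nat l + 1) * (2 * (of_nat l)\<^sup>2 + 2 * of_nat l + 1 - (of_nat N + 1)\<^sup>2) / 2"

text \<open>For $k = 0$ the first term has the coefficient $b_0 = 0$, so the truncated index $k - 1$
  does no harm; for $k = N$ the value $v_{N+1}$ has the coefficient $b_{N+1} = 0$.\<close>
definition jac_op :: "nat \<Rightarrow> (nat \<Rightarrow> complex) \<Rightarrow> nat \<Rightarrow> complex" where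
  "jac_op N v k = jac_off N k * v (k - 1) + jac_diag N k * v k + jac_off N (Suc k) * v (Suc k)"

lemma jac_off_0 [simp]: "jac_off N 0 = 0"
  by (simp add: jac_off_def)

lemma jac_off_end [simp]: "jac_off N (Suc N) = 0"
  by (simp add: jac_off_def algebra_simps)

lemma jac_off_nonzero:
  assumes "0 < l" "l \<le> N"
  shows "jac_off N l \<noteq> 0"
proof -
  have "(of_nat l :: complex)\<^sup>2 \<noteq> (of_nat (N + 1))\<^sup>2"
    using assms by (simp only: of_nat_power[symmetric] of_nat_eq_iff power2_eq_iff_nonneg)
  then show ?thesis using assms by (simp add: jac_off_def add.commute)
qed

text \<open>Green's formula for the tridiagonal operator: only a boundary term survives.\<close>
lemma jac_op_symmetric_gen:
  "(\<Sum>k\<le>m. f k * jac_op N g k) - (\<Sum>k\<le>m. jac_op N f k * g k)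
    = jac_off N (Suc m) * (f m * g (Suc m) - f (Suc m) * g m)"
  by (induction m) (simp_all add: jac_op_def algebra_simps)

lemma jac_op_symmetric:
  "(\<Sum>k\<le>N. f k * jac_op N g k) = (\<Sum>k\<le>N. jac_op N f k * g k)"
  using jac_op_symmetric_gen[of f N g N] by simp

text \<open>The commutation of $J$ and $T$ entry by entry: $J$ may act on either index of
  $\binom{j+k}{j}$. The neighbours of this binomial coefficient are rational multiples of it
  with denominators $j+k$, $j+1$ and $k+1$. The off-diagonal coefficients absorb the last two;
  after multiplication by $2(j+k)$ the claim is a polynomial identity in $j$, $k$ and $N$.\<close>
lemma jac_op_choose_commute:
  "jac_op N (\<lambda>i. of_nat ((i + k) choose i)) j = jac_op N (\<lambda>i. of_nat ((j + i) choose j)) k"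
proof (cases "j + k = 0")
  case False
  define c :: complex where "c = of_nat ((j + k) choose j)"
  define x :: complex where "x = of_nat j"
  define y :: complex where "y = of_nat k"
  define M :: complex where "M = of_nat N + 1"
  have nz: "x + y \<noteq> 0"
    using False by (simp add: x_def y_def flip: of_nat_add)
  have down: "(x + y) * (jac_off N j * of_nat ((j - 1 + k) choose (j - 1))) = x\<^sup>2 * (x\<^sup>2 - M\<^sup>2) * c"
  proof (cases j)
    case (Suc i)
    have "(j + k) * ((j - 1 + k) choose (j - 1)) = j * ((j + k) choose j)"
      using Suc_times_binomial_eq[of "i + k" i] Suc by simp
    then have "(x + y) * of_nat ((j - 1 + k) choose (j - 1)) = x * c"
      unfolding x_def y_def c_def by (metis of_nat_add of_nat_mult)
    then show ?thesis
      by (simp add: jac_off_def x_def[symmetric] M_def[symmetric] power2_eq_square) algebra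
  qed (simp add: x_def)
  have down': "(x + y) * (jac_off N k * of_nat ((j + (k - 1)) choose j)) = y\<^sup>2 * (y\<^sup>2 - M\<^sup>2) * c"
  proof (cases k)
    case (Suc i)
    have "(j + k) * ((j + (k - 1)) choose j) = k * ((j + k) choose j)"
      using binomial_absorb_comp[of "j + k" j] Suc by simp
    then have "(x + y) * of_nat ((j + (k - 1)) choose j) = y * c"
      unfolding x_def y_def c_def by (metis of_nat_add of_nat_mult)
    then show ?thesis
      by (simp add: jac_off_def y_def[symmetric] M_def[symmetric] power2_eq_square) algebra
  qed (simp add: y_def)
  have up: "jac_off N (Suc j) * of_nat ((Suc j + k) choose (Suc j)) = ((x + 1)\<^sup>2 - M\<^sup>2) * (x + y + 1) * c"
  proof -
    have "Suc j * ((Suc j + k) choose (Suc j)) = Suc (j + k) * ((j + k) choose j)"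
      using Suc_times_binomial_eq[of "j + k" j] by (simp add: mult_ac)
    then have "(x + 1) * of_nat ((Suc j + k) choose (Suc j)) = (x + y + 1) * c"
      unfolding x_def y_def c_def by (metis of_nat_add of_nat_mult of_nat_Suc add.commute)
    then show ?thesis
      by (simp add: jac_off_def x_def[symmetric] M_def[symmetric] add.commute[of 1 x] del: binomial_Suc_Suc) algebra
  qed
  have up': "jac_off N (Suc k) * of_nat ((j + Suc k) choose j) = ((y + 1)\<^sup>2 - M\<^sup>2) * (x + y + 1) * c"
  proof -
    have "Suc k * ((j + Suc k) choose j) = Suc (j + k) * ((j + k) choose j)"
      using binomial_absorb_comp[of "Suc (j + k)" j] by simp
    then have "(y + 1) * of_nat ((j + Suc k) choose j) = (x + y + 1) * c"
      unfolding x_def y_def c_def by (metis of_nat_add of_nat_mult of_nat_Suc add.commute)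
    then show ?thesis
      by (simp add: jac_off_def y_def[symmetric] M_def[symmetric] add.commute[of 1 y]) algebra
  qed
  have diag: "2 * jac_diag N j = - (2 * x + 1) * (2 * x\<^sup>2 + 2 * x + 1 - M\<^sup>2)"
    "2 * jac_diag N k = - (2 * y + 1) * (2 * y\<^sup>2 + 2 * y + 1 - M\<^sup>2)"
    by (simp_all add: jac_diag_def x_def y_def M_def)
  \<comment> \<open>The factor $x + y$ clears the denominator of the lower neighbours, the factor 2 that of the diagonal.\<close>
  have expand: "2 * (x + y) * (A + D * c + B) = 2 * ((x + y) * A) + (x + y) * (2 * D) * c + 2 * (x + y) * B"
    for A D B by (simp add: algebra_simps)
  have "2 * (x + y) * jac_op N (\<lambda>i. of_nat ((i + k) choose i)) j
      = 2 * (x + y) * jac_op N (\<lambda>i. of_nat ((j + i) choose j)) k"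
    unfolding jac_op_def c_def[symmetric] expand down down' up up' diag by (simp add: algebra_simps power2_eq_square)
  moreover have "2 * (x + y) \<noteq> 0"
    using nz by (simp del: distrib_left_numeral)
  ultimately show ?thesis
    using mult_left_cancel by blast
qed simp

lemma jac_pascal_commute:
  "jac_op N (pascal_op N v) j = pascal_op N (jac_op N v) j"
proof -
  have "jac_op N (pascal_op N v) j
      = (\<Sum>k\<le>N. jac_op N (\<lambda>i. of_nat ((i + k) choose i)) j * v k)"
    by (simp add: jac_op_def pascal_op_def sum_distrib_left sum.distrib[symmetric] algebra_simps del: binomial_Suc_Suc)
  also have "\<dots> = (\<Sum>k\<le>N. jac_op N (\<lambda>i. of_nat ((j + i) choose j)) k * v k)"
    by (simp only: jac_op_choose_commute)
  also have "\<dots> = (\<Sum>k\<le>N. of_nat ((j + k) choose j) * jac_op N v k)"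
    by (rule jac_op_symmetric[symmetric])
  finally show ?thesis by (simp add: pascal_op_def)
qed

text \<open>A three-term recurrence with nonzero leading coefficients leaves only one free parameter.\<close>
lemma jac_kernel_eq_0:
  assumes ker: "\<And>k. k < N \<Longrightarrow> jac_op N w k = 0" and w0: "w 0 = 0" and "k \<le> N"
  shows "w k = 0"
  using \<open>k \<le> N\<close>
proof (induction k rule: less_induct)
  case (less k)
  show ?case
  proof (cases k)
    case (Suc i)
    have "w i = 0" "w (i - 1) = 0" using less Suc by auto
    then have "jac_off N k * w k = 0"
      using ker[of i] less.prems Suc by (simp add: jac_op_def)
    then show ?thesis using jac_off_nonzero[of k N] less.prems Suc by simp
  qed (simp add: w0)
qed

text \<open>Since $T$ commutes with $J$, it maps the kernel of $J$ to itself, so $Te - e$ lies in the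
  kernel. The hypothesis on the sum says that its first entry vanishes, and then so does all
  of it.\<close>
lemma jac_kernel_pascal_fixed:
  assumes ker: "\<And>k. k \<le> N \<Longrightarrow> jac_op N e k = 0" and sum: "(\<Sum>k\<le>N. e k) = e 0" and "j \<le> N"
  shows "pascal_op N e j = e j"
proof -
  have "pascal_op N e j - e j = 0"
  proof (rule jac_kernel_eq_0[of N "\<lambda>j. pascal_op N e j - e j"])
    fix k assume "k < N"
    have "jac_op N (\<lambda>j. pascal_op N e j - e j) k = jac_op N (pascal_op N e) k - jac_op N e k"
      by (simp add: jac_op_def algebra_simps)
    also have "\<dots> = 0"
      using ker \<open>k < N\<close> by (simp add: jac_pascal_commute pascal_op_def)
    finally show "jac_op N (\<lambda>j. pascal_op N e j - e j) k = 0" .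
  qed (use sum \<open>j \<le> N\<close> in \<open>simp_all add: pascal_op_def\<close>)
  then show ?thesis by simp
qed

section \<open>Terminating hypergeometric polynomials\<close>

definition hyp_coeff :: "nat \<Rightarrow> complex \<Rightarrow> complex \<Rightarrow> nat \<Rightarrow> complex" where
  "hyp_coeff n b c k = pochhammer (- of_nat n) k * pochhammer b k / (pochhammer c k * fact k)"

definition hyp2F1 :: "nat \<Rightarrow> complex \<Rightarrow> complex \<Rightarrow> complex poly" where
  "hyp2F1 n b c = (\<Sum>k\<le>n. monom (hyp_coeff n b c k) k)"

lemma hyp_coeff_eq_0: "n < k \<Longrightarrow> hyp_coeff n b c k = 0"
  by (simp add: hyp_coeff_def pochhammer_of_nat_eq_0_lemma)

lemma coeff_hyp2F1: "coeff (hyp2F1 n b c) k = hyp_coeff n b c k"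
  by (auto simp: hyp2F1_def coeff_sum hyp_coeff_eq_0)

lemma poly_hyp2F1: "poly (hyp2F1 n b c) x = (\<Sum>k\<le>n. hyp_coeff n b c k * x ^ k)"
  by (simp add: hyp2F1_def poly_sum poly_monom)

lemma degree_hyp2F1: "degree (hyp2F1 n b c) \<le> n"
  by (rule degree_le) (simp add: coeff_hyp2F1 hyp_coeff_eq_0)

lemma chu_vandermonde:
  assumes "\<And>k. k < n \<Longrightarrow> c + of_nat k \<noteq> 0"
  shows "(\<Sum>k\<le>n. hyp_coeff n b c k) = pochhammer (c - b) n / pochhammer c n"
proof -
  have "\<forall>i\<in>{0..<n}. c \<noteq> - of_nat i"
    using assms by (metis add.left_inverse atLeastLessThan_iff)
  from Vandermonde_pochhammer[OF this, of b] show ?thesis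
    by (simp add: hyp_coeff_def mult_ac atLeast0AtMost)
qed

lemma pochhammer_neg_nat_choose:
  "pochhammer (- of_nat n :: 'a::field_char_0) k = (- 1) ^ k * of_nat (n choose k) * fact k"
  by (simp add: binomial_gbinomial gbinomial_pochhammer mult.assoc[symmetric] power_mult_distrib[symmetric])

text \<open>The trinomial revision that reduces the coefficients in Pfaff's transformation to
  Chu--Vandermonde sums of length $m$.\<close>
lemma hyp_coeff_choose:
  assumes "k \<le> m" "m \<le> n"
  shows "hyp_coeff n b c k * of_nat ((n - k) choose (m - k)) = of_nat (n choose m) * hyp_coeff m b c k"
proof -
  have "of_nat (n choose m) * of_nat (m choose k) = (of_nat (n choose k) * of_nat ((n - k) choose (m - k)) :: complex)"
    using choose_mult[OF assms] by (metis of_nat_mult)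
  then show ?thesis
    by (simp add: hyp_coeff_def pochhammer_neg_nat_choose mult_ac)
qed

lemma binomial_shift_sum:
  fixes z :: "'a::comm_ring_1"
  assumes "k \<le> n"
  shows "(- z) ^ k * (1 - z) ^ (n - k)
    = (\<Sum>m\<le>n. if k \<le> m then of_nat ((n - k) choose (m - k)) * (- z) ^ m else 0)"
proof -
  have "(\<Sum>m\<le>n. if k \<le> m then of_nat ((n - k) choose (m - k)) * (- z) ^ m else 0)
      = (\<Sum>m\<in>{m. m \<le> n \<and> k \<le> m}. of_nat ((n - k) choose (m - k)) * (- z) ^ m)"
    by (simp add: sum.If_cases Int_def)
  also have "\<dots> = (\<Sum>j\<le>n - k. of_nat ((n - k) choose j) * (- z) ^ (j + k))"
    using assms by (intro sum.reindex_bij_witness[of _ "\<lambda>j. j + k" "\<lambda>m. m - k"]) auto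
  also have "\<dots> = (- z) ^ k * (- z + 1) ^ (n - k)"
    by (simp only: binomial_ring[of "- z" 1] sum_distrib_left power_add) (simp add: mult_ac)
  finally show ?thesis by simp
qed

text \<open>Pfaff's transformation in the terminating case. Clearing denominators gives $\sum_k h_k
  (-z)^k (1-z)^{n-k}$; the coefficient of $z^m$ in this polynomial is a Chu--Vandermonde sum.\<close>
lemma pfaff_transformation:
  assumes c: "\<And>k. k < n \<Longrightarrow> c + of_nat k \<noteq> 0" and "z \<noteq> 1"
  shows "poly (hyp2F1 n b c) (z / (z - 1)) * (1 - z) ^ n = poly (hyp2F1 n (c - b) c) z"
proof -
  have pow: "(z / (z - 1)) ^ k * (1 - z) ^ n = (- z) ^ k * (1 - z) ^ (n - k)" if "k \<le> n" for k
  proof -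
    have "(1 - z) ^ n = (1 - z) ^ k * (1 - z) ^ (n - k)"
      using that by (simp flip: power_add)
    moreover have "z / (z - 1) * (1 - z) = - z"
      using \<open>z \<noteq> 1\<close> by (simp add: field_simps)
    ultimately show ?thesis by (metis mult.assoc power_mult_distrib)
  qed
  have coeff: "(\<Sum>k\<le>m. hyp_coeff n b c k * of_nat ((n - k) choose (m - k))) * (- z) ^ m
      = hyp_coeff n (c - b) c m * z ^ m" if "m \<le> n" for m
  proof -
    have "(\<Sum>k\<le>m. hyp_coeff n b c k * of_nat ((n - k) choose (m - k)))
        = of_nat (n choose m) * (\<Sum>k\<le>m. hyp_coeff m b c k)"
      using that by (simp add: hyp_coeff_choose sum_distrib_left)
    also have "\<dots> = of_nat (n choose m) * (pochhammer (c - b) m / pochhammer c m)"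
      using that c by (subst chu_vandermonde) auto
    finally show ?thesis
      by (simp add: hyp_coeff_def pochhammer_neg_nat_choose power_minus[of z] mult_ac)
  qed
  have "poly (hyp2F1 n b c) (z / (z - 1)) * (1 - z) ^ n
      = (\<Sum>k\<le>n. hyp_coeff n b c k * ((- z) ^ k * (1 - z) ^ (n - k)))"
    by (simp add: poly_hyp2F1 sum_distrib_right mult.assoc pow)
  also have "\<dots> = (\<Sum>k\<le>n. \<Sum>m\<le>n. if k \<le> m
      then hyp_coeff n b c k * of_nat ((n - k) choose (m - k)) * (- z) ^ m else 0)"
    by (simp add: binomial_shift_sum sum_distrib_left if_distrib mult.assoc cong: if_cong)
  also have "\<dots> = (\<Sum>m\<le>n. \<Sum>k\<le>n. if k \<le> m
      then hyp_coeff n b c k * of_nat ((n - k) choose (m - k)) * (- z) ^ m else 0)"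
    by (rule sum.swap)
  also have "\<dots> = (\<Sum>m\<le>n. hyp_coeff n (c - b) c m * z ^ m)"
  proof (intro sum.cong refl)
    fix m assume m: "m \<in> {..n}"
    then have "{k. k \<le> n \<and> k \<le> m} = {..m}" by auto
    then show "(\<Sum>k\<le>n. if k \<le> m then hyp_coeff n b c k * of_nat ((n - k) choose (m - k)) * (- z) ^ m else 0)
        = hyp_coeff n (c - b) c m * z ^ m"
      using m coeff[of m] by (simp add: sum.If_cases Int_def sum_distrib_right)
  qed
  finally show ?thesis by (simp add: poly_hyp2F1)
qed

lemma hyp2F1_product_coeff_top:
  "coeff (hyp2F1 n b c * hyp2F1 n b' c) (2 * n) = hyp_coeff n b c n * hyp_coeff n b' c n"
proof -
  have "coeff (hyp2F1 n b c * hyp2F1 n b' c) (2 * n)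
      = (\<Sum>i\<le>2 * n. hyp_coeff n b c i * hyp_coeff n b' c (2 * n - i))"
    by (simp add: coeff_mult coeff_hyp2F1)
  also have "\<dots> = (\<Sum>i\<in>{n}. hyp_coeff n b c i * hyp_coeff n b' c (2 * n - i))"
  proof (rule sum.mono_neutral_right)
    show "\<forall>i\<in>{..2 * n} - {n}. hyp_coeff n b c i * hyp_coeff n b' c (2 * n - i) = 0"
    proof
      fix i assume "i \<in> {..2 * n} - {n}"
      then have "n < i \<or> n < 2 * n - i" by auto
      then show "hyp_coeff n b c i * hyp_coeff n b' c (2 * n - i) = 0"
        by (auto simp: hyp_coeff_eq_0)
    qed
  qed auto
  finally show ?thesis by (simp add: mult_2)
qed

text \<open>By Chu--Vandermonde the value of each factor at $1$ is, up to the sign $(-1)^n$, the leading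
  coefficient of the other factor.\<close>
lemma hyp2F1_product_at_1:
  assumes c: "\<And>k. k < n \<Longrightarrow> c + of_nat k \<noteq> 0"
  shows "poly (hyp2F1 n b c * hyp2F1 n (c - b) c) 1
    = coeff (hyp2F1 n b c * hyp2F1 n (c - b) c) (2 * n)"
proof -
  have "poly (hyp2F1 n b c) 1 = pochhammer (c - b) n / pochhammer c n" for b
    using chu_vandermonde[of n c b, OF c] by (simp add: poly_hyp2F1)
  moreover have "hyp_coeff n b c n = (- 1) ^ n * (pochhammer b n / pochhammer c n)" for b
    by (simp add: hyp_coeff_def pochhammer_same)
  ultimately show ?thesis
    by (simp add: hyp2F1_product_coeff_top flip: power_mult_distrib)
qed

section \<open>The differential equation of the product\<close>

text \<open>At $k = n$ both sides vanish, so the recurrence also covers the place where the series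
  terminates.\<close>
lemma hyp_coeff_Suc:
  assumes "\<And>k. k < n \<Longrightarrow> c + of_nat k \<noteq> 0"
  shows "of_nat (Suc k) * (of_nat k + c) * hyp_coeff n b c (Suc k)
    = (of_nat k - of_nat n) * (of_nat k + b) * hyp_coeff n b c k"
proof (cases "k < n")
  case True
  have "of_nat (Suc k) * (of_nat k + c) * hyp_coeff n b c (Suc k)
      = (of_nat (Suc k) * (c + of_nat k)) * ((of_nat k - of_nat n) * (of_nat k + b))
        * (pochhammer (- of_nat n) k * pochhammer b k)
        / ((of_nat (Suc k) * (c + of_nat k)) * (pochhammer c k * fact k))"
    by (simp add: hyp_coeff_def pochhammer_Suc mult_ac add.commute del: of_nat_Suc)
  also have "\<dots> = (of_nat k - of_nat n) * (of_nat k + b) * hyp_coeff n b c k"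
    using assms[OF True] unfolding hyp_coeff_def
    by (simp add: mult.assoc del: of_nat_Suc)
  finally show ?thesis .
next
  case False
  then show ?thesis by (cases "k = n") (simp_all add: hyp_coeff_eq_0)
qed

lemma hyp2F1_ode:
  fixes b c :: complex
  assumes "\<And>k. k < n \<Longrightarrow> c + of_nat k \<noteq> 0"
  defines "y \<equiv> hyp2F1 n b c"
  shows "[:0, 1:] * (1 - [:0, 1:]) * pderiv (pderiv y)
    = [:- c, b - of_nat n + 1:] * pderiv y - [:of_nat n * b:] * y"
proof (rule poly_eqI)
  fix k
  have rec: "of_nat (Suc k) * (of_nat k + c) * coeff y (Suc k)
    = (of_nat k - of_nat n) * (of_nat k + b) * coeff y k"
    unfolding y_def coeff_hyp2F1 by (rule hyp_coeff_Suc) (rule assms)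
  show "coeff ([:0, 1:] * (1 - [:0, 1:]) * pderiv (pderiv y)) k
    = coeff ([:- c, b - of_nat n + 1:] * pderiv y - [:of_nat n * b:] * y) k"
  proof (cases k)
    case 0
    then show ?thesis using rec by (simp add: coeff_pderiv algebra_simps)
  next
    case (Suc i)
    then show ?thesis using rec
      by (cases i) (simp_all add: coeff_pderiv algebra_simps)
  qed
qed

lemma denom_nonzero: "k < n \<Longrightarrow> - of_nat (2 * n) + of_nat k \<noteq> (0::complex)"
  by (metis add.commute add_eq_0_iff add.inverse_inverse less_irrefl of_nat_eq_iff mult_2 not_add_less1)

text \<open>The elimination behind the differential equation of a product $R = pq$, with $p_i$ and $q_i$
  in place of the derivatives. The second-order equations (and their derivatives) reduce $w
  R''$ and $w^2 R^{(3)}$, where $w = z(1-z)$, to combinations of $p'q'$, $p'q$, $pq'$ and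
  $pq$. The product of solutions of two second-order equations satisfies in general an
  equation of order four; here the order drops to three because, once the term with $p'q'$ is
  removed, $p'q$ and $pq'$ occur with the same coefficient and combine to $R'$.\<close>
lemma product_ode_algebra:
  fixes z n :: "'a::comm_ring_1"
  assumes P1: "z * (1 - z) * p2 = 2 * (n + z) * p1 - n * (n + 1) * p0"
    and P2: "z * (1 - z) * p3 + (1 - 2 * z) * p2 = 2 * (n + z) * p2 + 2 * p1 - n * (n + 1) * p1"
    and Q1: "z * (1 - z) * q2 = (2 * n - 4 * n * z) * q1 + n * (3 * n + 1) * q0"
    and Q2: "z * (1 - z) * q3 + (1 - 2 * z) * q2 = (2 * n - 4 * n * z) * q2 - 4 * n * q1 + n * (3 * n + 1) * q1"
  shows "(z * (1 - z)) * (z * (1 - z)) * (p3 * q0 + 3 * (p2 * q1) + 3 * (p1 * q2) + p0 * q3)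
      + z * (1 - z) * ((6 * n - 3) * z - 6 * n) * (p2 * q0 + 2 * (p1 * q1) + p0 * q2)
      + (8 * n * n + 2 * n - (20 * n * n - 4 * n) * z + (8 * n * n - 10 * n) * z * z) * (p1 * q0 + p0 * q1)
      + 2 * n * (4 * n + 1) * (n + z) * (p0 * q0) = 0"
proof -
  define w where "w = z * (1 - z)"
  note P1 = P1[folded w_def] and P2 = P2[folded w_def] and Q1 = Q1[folded w_def] and Q2 = Q2[folded w_def]
  have w2: "w * w * (p3 * q0 + 3 * (p2 * q1) + 3 * (p1 * q2) + p0 * q3)
    = w * (w * p3 + (1 - 2 * z) * p2) * q0 + 3 * w * (w * p2) * q1
      + 3 * w * (w * q2) * p1 + w * (w * q3 + (1 - 2 * z) * q2) * p0
      - (1 - 2 * z) * ((w * p2) * q0 + (w * q2) * p0)"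
    by (simp add: algebra_simps)
  have w1: "w * ((6 * n - 3) * z - 6 * n) * (p2 * q0 + 2 * (p1 * q1) + p0 * q2)
    = ((6 * n - 3) * z - 6 * n) * ((w * p2) * q0 + 2 * w * p1 * q1 + (w * q2) * p0)"
    by (simp add: algebra_simps)
  have w3: "w * (2 * (n + z) * p2 + 2 * p1 - n * (n + 1) * p1)
     = 2 * (n + z) * (w * p2) + w * (2 * p1 - n * (n + 1) * p1)"
    "w * ((2 * n - 4 * n * z) * q2 - 4 * n * q1 + n * (3 * n + 1) * q1)
     = (2 * n - 4 * n * z) * (w * q2) + w * (- 4 * n * q1 + n * (3 * n + 1) * q1)"
    by (simp_all add: algebra_simps)
  show ?thesis
    unfolding w_def[symmetric] w2 w1 P2 Q2 w3 P1 Q1 unfolding w_def by (simp add: algebra_simps)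
qed

text \<open>The two factors are the polynomials $p$ and $q$ of the introduction; $q$ is the Pfaff
  transform of $p$ because $-2n - (n + 1) = -3n - 1$.\<close>
lemma hyp2F1_product_ode:
  fixes n :: nat
  defines "p \<equiv> hyp2F1 n (of_nat n + 1) (- of_nat (2 * n))"
    and "q \<equiv> hyp2F1 n (- 3 * of_nat n - 1) (- of_nat (2 * n))"
  defines "R \<equiv> p * q" and "z \<equiv> [:0, 1:] :: complex poly" and "n' \<equiv> of_nat n :: complex poly"
  shows "(z * (1 - z)) * (z * (1 - z)) * pderiv (pderiv (pderiv R))
      + z * (1 - z) * ((6 * n' - 3) * z - 6 * n') * pderiv (pderiv R)
      + (8 * n' * n' + 2 * n' - (20 * n' * n' - 4 * n') * z + (8 * n' * n' - 10 * n') * z * z) * pderiv R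
      + 2 * n' * (4 * n' + 1) * (n' + z) * R = 0"
proof -
  have n': "n' = [:of_nat n:]" by (simp add: n'_def of_nat_poly)
  have dz: "pderiv z = 1" and dn: "pderiv n' = 0" by (simp_all add: z_def n' pderiv_pCons)
  have P1: "z * (1 - z) * pderiv (pderiv p) = 2 * (n' + z) * pderiv p - n' * (n' + 1) * p"
  proof -
    have "2 * (n' + z) = [:2 * of_nat n, 2:]" "n' * (n' + 1) = [:of_nat n * (of_nat n + 1):]"
      by (simp_all add: n' z_def numeral_poly one_pCons)
    then show ?thesis
      using hyp2F1_ode[of n "- of_nat (2 * n)" "of_nat n + 1", OF denom_nonzero] by (simp add: p_def z_def)
  qed
  have Q1: "z * (1 - z) * pderiv (pderiv q) = (2 * n' - 4 * n' * z) * pderiv q + n' * (3 * n' + 1) * q"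
  proof -
    have A: "[:- (- of_nat (2 * n)), - 3 * of_nat n - 1 - of_nat n + 1:] = 2 * n' - 4 * n' * z"
      and B: "[:of_nat n * (- 3 * of_nat n - 1):] = - (n' * (3 * n' + 1))"
      by (simp_all add: n' z_def numeral_poly one_pCons algebra_simps)
    show ?thesis
      using hyp2F1_ode[of n "- of_nat (2 * n)" "- 3 * of_nat n - 1", OF denom_nonzero]
      unfolding A B q_def[symmetric] z_def[symmetric] by (simp only: mult_minus_left diff_minus_eq_add)
  qed
  have P2: "z * (1 - z) * pderiv (pderiv (pderiv p)) + (1 - 2 * z) * pderiv (pderiv p)
      = 2 * (n' + z) * pderiv (pderiv p) + 2 * pderiv p - n' * (n' + 1) * pderiv p"
    using arg_cong[OF P1, of pderiv]
    by (simp add: pderiv_mult pderiv_diff pderiv_add dz dn algebra_simps)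
  have Q2: "z * (1 - z) * pderiv (pderiv (pderiv q)) + (1 - 2 * z) * pderiv (pderiv q)
      = (2 * n' - 4 * n' * z) * pderiv (pderiv q) - 4 * n' * pderiv q + n' * (3 * n' + 1) * pderiv q"
    using arg_cong[OF Q1, of pderiv]
    by (simp add: pderiv_mult pderiv_diff pderiv_add dz dn algebra_simps)
  have R1: "pderiv R = pderiv p * q + p * pderiv q"
    and R2: "pderiv (pderiv R) = pderiv (pderiv p) * q + 2 * (pderiv p * pderiv q) + p * pderiv (pderiv q)"
    and R3: "pderiv (pderiv (pderiv R)) = pderiv (pderiv (pderiv p)) * q + 3 * (pderiv (pderiv p) * pderiv q)
      + 3 * (pderiv p * pderiv (pderiv q)) + p * pderiv (pderiv (pderiv q))"
    by (simp_all add: R_def pderiv_mult pderiv_add algebra_simps)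
  show ?thesis
    unfolding R3 unfolding R2 unfolding R1 unfolding R_def by (rule product_ode_algebra[OF P1 P2 Q1 Q2])
qed

text \<open>Read backwards, the coefficient sequence of a polynomial solution lies in the kernel of $J$
  for $N = 2n$: row $k$ of $J$ is, up to sign, the coefficient of $z^{N-k}$ in the
  differential equation.\<close>
lemma ode_recurrence:
  fixes n :: nat and R :: "complex poly"
  defines "z \<equiv> [:0, 1:] :: complex poly" and "n' \<equiv> of_nat n :: complex poly"
  assumes ode: "(z * (1 - z)) * (z * (1 - z)) * pderiv (pderiv (pderiv R))
      + z * (1 - z) * ((6 * n' - 3) * z - 6 * n') * pderiv (pderiv R)
      + (8 * n' * n' + 2 * n' - (20 * n' * n' - 4 * n') * z + (8 * n' * n' - 10 * n') * z * z) * pderiv R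
      + 2 * n' * (4 * n' + 1) * (n' + z) * R = 0"
    and "k \<le> 2 * n"
  shows "jac_op (2 * n) (\<lambda>k. coeff R (2 * n - k)) k = 0"
proof -
  define N where "N = (of_nat n :: complex)"
  have n': "n' = [:N:]" by (simp add: n'_def N_def of_nat_poly)
  define m where "m = 2 * n - k"
  have "(z * (1 - z)) * (z * (1 - z)) = [:0, 0, 1, - 2, 1:]"
    and "z * (1 - z) * ((6 * n' - 3) * z - 6 * n') = [:0, - 6 * N, 12 * N - 3, 3 - 6 * N:]"
    and "8 * n' * n' + 2 * n' - (20 * n' * n' - 4 * n') * z + (8 * n' * n' - 10 * n') * z * z
      = [:8 * N * N + 2 * N, - (20 * N * N - 4 * N), 8 * N * N - 10 * N:]"
    and "2 * n' * (4 * n' + 1) * (n' + z) = [:2 * N * (4 * N + 1) * N, 2 * N * (4 * N + 1):]"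
    by (simp_all add: z_def n' numeral_poly one_pCons algebra_simps)
  moreover define L where "L = [:0, 0, 1, - 2, 1:] * pderiv (pderiv (pderiv R))
      + [:0, - 6 * N, 12 * N - 3, 3 - 6 * N:] * pderiv (pderiv R)
      + [:8 * N * N + 2 * N, - (20 * N * N - 4 * N), 8 * N * N - 10 * N:] * pderiv R
      + [:2 * N * (4 * N + 1) * N, 2 * N * (4 * N + 1):] * R"
  ultimately have "L = 0"
    using ode by simp
  have k: "of_nat k = 2 * N - of_nat m"
    using \<open>k \<le> 2 * n\<close> by (simp add: m_def N_def of_nat_diff)
  have off: "jac_off (2 * n) k = (2 * N - of_nat m) * ((2 * N - of_nat m)\<^sup>2 - (2 * N + 1)\<^sup>2)"
    and diag: "jac_diag (2 * n) k = - (2 * (2 * N - of_nat m) + 1)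
        * (2 * (2 * N - of_nat m)\<^sup>2 + 2 * (2 * N - of_nat m) + 1 - (2 * N + 1)\<^sup>2) / 2"
    and off': "jac_off (2 * n) (Suc k)
        = (2 * N - of_nat m + 1) * ((2 * N - of_nat m + 1)\<^sup>2 - (2 * N + 1)\<^sup>2)"
    by (simp_all add: jac_off_def jac_diag_def k N_def[symmetric] add.commute[of 1])
  have below: "jac_off (2 * n) k * coeff R (2 * n - (k - 1)) = jac_off (2 * n) k * coeff R (Suc m)"
    using \<open>k \<le> 2 * n\<close> by (cases k) (simp_all add: m_def jac_off_def Suc_diff_Suc)
  have "jac_op (2 * n) (\<lambda>k. coeff R (2 * n - k)) k = - coeff L m"
  proof (cases m)
    case 0
    then have "jac_off (2 * n) (Suc k) = 0" by (simp add: off' power2_eq_square)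
    then show ?thesis using 0
      unfolding jac_op_def below L_def unfolding m_def[symmetric] off diag
      by (simp add: coeff_pderiv field_simps power2_eq_square)
  next
    case (Suc i)
    then have above: "2 * n - Suc k = i" by (simp add: m_def)
    consider "i = 0" | "i = Suc 0" | "i = Suc (Suc 0)" | l where "i = Suc (Suc (Suc l))"
      by (metis not0_implies_Suc)
    then show ?thesis
      using Suc
      unfolding jac_op_def below L_def unfolding m_def[symmetric] off diag off' above
      by cases (simp_all add: coeff_pderiv field_simps power2_eq_square)
  qed
  then show ?thesis using \<open>L = 0\<close> by simp
qed

lemma product_recurrence:
  fixes n :: nat
  defines "c \<equiv> - of_nat (2 * n)"
  assumes "k \<le> 2 * n"
  shows "jac_op (2 * n) (\<lambda>k. coeff (hyp2F1 n (of_nat n + 1) c * hyp2F1 n (- 3 * of_nat n - 1) c) (2 * n - k)) k = 0"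
  unfolding c_def using hyp2F1_product_ode[of n] assms(2) by (rule ode_recurrence)

section \<open>The eigenvector with eigenvalue one\<close>

lemma poly_reversed_sum:
  fixes R :: "'a::comm_semiring_1 poly"
  assumes "degree R \<le> N"
  shows "(\<Sum>k\<le>N. coeff R (N - k) * z ^ (N - k)) = poly R z"
proof -
  have "(\<Sum>k\<le>N. coeff R (N - k) * z ^ (N - k)) = (\<Sum>m\<le>N. coeff R m * z ^ m)"
    by (rule sum.reindex_bij_witness[of _ "\<lambda>m. N - m" "\<lambda>k. N - k"]) auto
  also have "\<dots> = (\<Sum>m\<le>degree R. coeff R m * z ^ m)"
    using assms by (intro sum.mono_neutral_right) (auto simp: coeff_eq_0)
  finally show ?thesis by (simp add: poly_altdef)
qed

lemma hyp_poly_eq: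
  "hyp_poly (2 * n) x = poly (hyp2F1 n (of_nat n + 1) (- of_nat (2 * n))) x"
  by (simp add: hyp_poly_def poly_hyp2F1 hyp_coeff_def atLeast0AtMost)

lemma eigenvector_sym_pascal_iff:
  "eigenvector (sym_pascal_mat N) v 1 \<longleftrightarrow>
     v \<in> carrier_vec (N + 1) \<and> v \<noteq> 0\<^sub>v (N + 1) \<and> (\<forall>j\<le>N. pascal_op N (\<lambda>k. v $ k) j = v $ j)"
proof -
  have "(sym_pascal_mat N *\<^sub>v v) $ j = pascal_op N (\<lambda>k. v $ k) j"
    if "v \<in> carrier_vec (N + 1)" "j \<le> N" for j
    using that by (simp add: sym_pascal_mat_def pascal_op_def scalar_prod_def atLeast0LessThan
        lessThan_Suc_atMost)
  then have "sym_pascal_mat N *\<^sub>v v = v \<longleftrightarrow> (\<forall>j\<le>N. pascal_op N (\<lambda>k. v $ k) j = v $ j)"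
    if "v \<in> carrier_vec (N + 1)"
    using that by (auto simp: vec_eq_iff sym_pascal_mat_def less_Suc_eq_le)
  then show ?thesis
    by (auto simp: eigenvector_def sym_pascal_mat_def)
qed

theorem theoremA:
  fixes N :: nat
  assumes "even N"
  shows "(\<exists>!v. eigenvector (sym_pascal_mat N) v 1 \<and> v $ N = 1) \<and>
    (\<forall>v. eigenvector (sym_pascal_mat N) v 1 \<and> v $ N = 1 \<longrightarrow>
      (\<forall>z::complex. z \<noteq> 1 \<longrightarrow>
        (\<Sum>k = 0..N. v $ k * z ^ (N - k)) =
          hyp_poly N z * hyp_poly N (z / (z - 1)) * (1 - z) ^ (N div 2)))"
proof -
  obtain n where N: "N = 2 * n" using assms by (rule evenE)
  define c :: complex where "c = - of_nat (2 * n)"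
  define b :: complex where "b = of_nat n + 1"
  define p where "p = hyp2F1 n b c"
  define q where "q = hyp2F1 n (c - b) c"
  define e where "e k = coeff (p * q) (N - k)" for k
  have c: "c + of_nat k \<noteq> 0" if "k < n" for k
    using denom_nonzero[OF that] by (simp add: c_def)
  have cb: "c - b = - 3 * of_nat n - 1" by (simp add: c_def b_def)
  have deg: "degree (p * q) \<le> N"
    using degree_mult_le[of p q] degree_hyp2F1[of n b c] degree_hyp2F1[of n "c - b" c]
    unfolding N p_def q_def by linarith
  have e_N: "e N = 1"
    by (simp add: e_def p_def q_def coeff_mult coeff_hyp2F1 hyp_coeff_def)
  have ker: "jac_op N e k = 0" if "k \<le> N" for k
    using product_recurrence[of k n] that unfolding e_def[abs_def] p_def q_def cb N b_def c_def by simp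
  have "(\<Sum>k\<le>N. e k) = e 0"
    using poly_reversed_sum[OF deg, of 1] hyp2F1_product_at_1[of n c b, OF c]
    by (simp add: e_def p_def q_def N)
  then have fixed: "pascal_op N e j = e j" if "j \<le> N" for j
    using jac_kernel_pascal_fixed ker that by blast
  define v where "v = vec (N + 1) e"
  have v_nth: "v $ k = e k" if "k \<le> N" for k using that by (simp add: v_def)
  have v: "eigenvector (sym_pascal_mat N) v 1 \<and> v $ N = 1"
  proof -
    have "pascal_op N (\<lambda>k. v $ k) j = pascal_op N e j" for j
      by (simp add: pascal_op_def v_nth)
    moreover have "v \<noteq> 0\<^sub>v (N + 1)"
      using v_nth[of N] e_N by auto
    ultimately show ?thesis
      by (simp add: eigenvector_sym_pascal_iff fixed v_nth e_N) (simp add: v_def)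
  qed
  have unique: "u = v" if u: "eigenvector (sym_pascal_mat N) u 1 \<and> u $ N = 1" for u
  proof (rule eq_vecI)
    fix i assume "i < dim_vec v"
    then have "i \<le> N" by (simp add: v_def)
    then show "u $ i = v $ i"
      using pascal_fixed_unique[of N "\<lambda>k. u $ k" "\<lambda>k. v $ k" i] u v
      by (simp add: eigenvector_sym_pascal_iff)
  qed (use u in \<open>simp add: eigenvector_sym_pascal_iff v_def\<close>)
  have gf: "(\<Sum>k = 0..N. v $ k * z ^ (N - k)) = hyp_poly N z * hyp_poly N (z / (z - 1)) * (1 - z) ^ (N div 2)"
    if "z \<noteq> 1" for z
  proof -
    have "(\<Sum>k = 0..N. v $ k * z ^ (N - k)) = poly (p * q) z"
      using poly_reversed_sum[OF deg, of z] by (simp add: v_nth e_def atLeast0AtMost)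
    also have "\<dots> = poly p z * (poly p (z / (z - 1)) * (1 - z) ^ n)"
      using pfaff_transformation[of n c z b, OF c that] by (simp add: p_def q_def)
    finally show ?thesis
      unfolding N by (simp add: hyp_poly_eq p_def b_def c_def mult.assoc)
  qed
  show ?thesis using v unique gf by blast
qed

end
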